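(* Let $\mathcal{S}=\{(i,j)\in\mathbb{Z}\times\mathbb{Z}\mid i\ge 2j\}$ and $\mathcal{S}'=\{(i,j)\in\mathbb{Z}\times\mathbb{Z}\mid i<2j\}$, and let $f:\mathcal{S}\times\mathcal{S}'\to\mathbb{F}_2$ be the function with $f((i,j),(l,m))=\binom{m-j-1}{m+j-l-1}$ modulo $2$ if $i+j=l+m$ and $f((i,j),(l,m))=0$ otherwise; let $f^!:\mathcal{S}'\times\mathcal{S}\to\mathbb{F}_2$ be $f^!(s',s)=f(s,s')$. Let $\mathcal{Q}$ be the universal Steenrod algebra over $\mathbb{F}_2$. Then: (1) $\mathcal{Q}$ is isomorphic to the quadratic algebra associated to the quadratic coalgebra $\langle\mathbb{Z};\mathcal{S}',f^!\rangle$; (2) $\mathcal{Q}$ is dualizable and is strictly self-dual.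
   Context: Convention: $\binom{a}{b}=0$ if $a<0$ or $b<0$ (or $b>a$). Universal Steenrod algebra: $\mathcal{Q}$ is the quadratic $\mathbb{F}_2$-algebra generated by elements $y_i$, $i\in\mathbb{Z}$, subject to the generalized Adem relations $$y_{2k-1-n}\,y_k=\sum_j\binom{n-1-j}{j}\,y_{2k-1-j}\,y_{k+j-n}\qquad(k\in\mathbb{Z},\ n\in\mathbb{N}).$$ Quadratic (co)algebras: for a field $\mathbb{K}$, a $\mathbb{K}$-vector space $V$ and a subspace $R\le V^{\otimes2}$, let $\langle V;R\rangle$ be the quadratic coalgebra given by $\mathbb{K}$ in degree $0$, $V$ in degree $1$ and $\bigcap_{i+j+2=n}V^{\otimes i}\otimes R\otimes V^{\otimes j}$ in degree $n\ge2$ (a graded subcoalgebra of the tensor coalgebra on $V$). The quadratic algebra associated to $\langle V;R\rangle$ is $\{V;R\}:=T(V)/\langle R\rangle$, the quotient of the tensor algebra by the two-sided ideal generated by $R$. Write $\mathbb{K}[\mathcal{I}]$ for the free $\mathbb{K}$-vector space on a set $\mathcal{I}$, with basis elements $[i]$, and identify $\mathbb{K}[\mathcal{I}]\otimes\mathbb{K}[\mathcal{I}]=\mathbb{K}[\mathcal{I}\times\mathcal{I}]$. Given a set $\mathcal{I}$, a subset $\mathcal{T}\subset\mathcal{I}\times\mathcal{I}$ with complement $\mathcal{T}'$, and a function $g:\mathcal{T}\times\mathcal{T}'\to\mathbb{K}$ such that $g(t,-)$ has finite support for each $t\in\mathcal{T}$, $\langle\mathcal{I};\mathcal{T},g\rangle$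 denotes the $(\mathcal{I},\mathcal{T})$-admissible quadratic coalgebra $\langle\mathbb{K}[\mathcal{I}];R\rangle$, where $R$ is the span of the elements $[t]-\sum_{t'\in\mathcal{T}'}g(t,t')[t']$, $t\in\mathcal{T}$. It is dualizable if $g(-,t')$ has finite support for each $t'\in\mathcal{T}'$. With $g^!(t',t)=g(t,t')$, a dualizable $\langle\mathcal{I};\mathcal{T},g\rangle$ is strictly self-dual if there is a bijection $\sigma:\mathcal{I}\to\mathcal{I}$ such that (applied componentwise to pairs) $\sigma$ restricts to a bijection $\mathcal{T}\to\mathcal{T}'$ and $g(t,t')=g^!(\sigma(t),\sigma(t'))$ for all $t\in\mathcal{T}$, $t'\in\mathcal{T}'$. An admissible quadratic algebra $\{\mathbb{K}[\mathcal{I}];R\}$ is called dualizable, resp. strictly self-dual, if the corresponding admissible quadratic coalgebra $\langle\mathbb{K}[\mathcal{I}];R\rangle$ is. In (2), $\mathcal{Q}$ is regarded as a $(\mathbb{Z},\mathcal{S}')$-admissible quadratic algebra via the basis $\{y_i\}_{i\in\mathbb{Z}}$ of generators. *)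

theory Defs
  imports Complex_Main "HOL-Library.Poly_Mapping" "HOL-Library.Z2" "HOL-Algebra.QuotRing" "HOL-Algebra.Module"
begin

section \<open>The tensor algebra on a free vector space\<close>

text \<open>
  Lists form the free monoid under concatenation. Hence the monoid algebra
  \<^typ>\<open>'i list \<Rightarrow>\<^sub>0 'k\<close>, with the convolution product, is the tensor algebra on the
  free vector space with basis the type \<^typ>\<open>'i\<close>; the word \<open>[i\<^sub>1, \<dots>, i\<^sub>n]\<close> stands for the tensor
  \<open>[i\<^sub>1] \<otimes> \<dots> \<otimes> [i\<^sub>n]\<close>.
\<close>

instantiation list :: (type) monoid_add
begin

definition zero_list :: "'a list" where "zero_list = []"

definition plus_list :: "'a list \<Rightarrow> 'a list \<Rightarrow> 'a list" where "plus_list u v = u @ v"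

instance by standard (simp_all add: zero_list_def plus_list_def)

end

type_synonym ('i, 'k) tensors = "'i list \<Rightarrow>\<^sub>0 'k"

definition scale :: "'k::field \<Rightarrow> ('i, 'k) tensors \<Rightarrow> ('i, 'k) tensors"
  where "scale c x = Poly_Mapping.single [] c * x"

global_interpretation tensors: vector_space "scale :: 'k::field \<Rightarrow> ('i, 'k) tensors \<Rightarrow> _"
proof
  fix a b :: 'k and x y :: "('i, 'k) tensors"
  show "scale a (x + y) = scale a x + scale a y"
    by (simp add: scale_def distrib_left)
  show "scale (a + b) x = scale a x + scale b x"
    by (simp add: scale_def single_add distrib_right)
  show "scale a (scale b x) = scale (a * b) x"
    by (simp add: scale_def mult.assoc[symmetric] mult_single plus_list_def)
  show "scale 1 x = x"
    by (simp add: scale_def zero_list_def[symmetric])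
qed

definition basis_word :: "'i list \<Rightarrow> ('i, 'k::field) tensors"
  where "basis_word w = Poly_Mapping.single w 1"

definition basis_pair :: "'i \<times> 'i \<Rightarrow> ('i, 'k::field) tensors"
  where "basis_pair t = basis_word [fst t, snd t]"

definition tensor_power :: "nat \<Rightarrow> ('i, 'k::field) tensors set"
  where "tensor_power n = {x. \<forall>w \<in> Poly_Mapping.keys x. length w = n}"


section \<open>Graded algebras and their quotients\<close>

record ('k, 'a) graded_algebra = "('k, 'a) module" +
  alg_degree :: "nat \<Rightarrow> 'a set"

definition tensor_algebra :: "('k::field, ('i, 'k) tensors) graded_algebra"
  where "tensor_algebra =
    \<lparr>carrier = UNIV, mult = (*), one = 1, zero = 0, add = (+),
     smult = scale, alg_degree = tensor_power\<rparr>"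

definition quotient_algebra ::
    "('k, 'a) graded_algebra \<Rightarrow> 'a set \<Rightarrow> ('k, 'a set) graded_algebra"
  where "quotient_algebra A J =
    \<lparr>carrier = carrier (A Quot J), mult = mult (A Quot J), one = one (A Quot J),
     zero = zero (A Quot J), add = add (A Quot J),
     smult = (\<lambda>c X. \<Union>x\<in>X. J +>\<^bsub>A\<^esub> (c \<odot>\<^bsub>A\<^esub> x)),
     alg_degree = (\<lambda>n. (\<lambda>x. J +>\<^bsub>A\<^esub> x) ` alg_degree A n)\<rparr>"

definition graded_algebra_iso ::
    "('k, 'a) graded_algebra \<Rightarrow> ('k, 'b) graded_algebra \<Rightarrow> ('a \<Rightarrow> 'b) set"
  where "graded_algebra_iso A B =
    {\<phi> \<in> ring_iso A B.
      (\<forall>c. \<forall>x \<in> carrier A. \<phi> (c \<odot>\<^bsub>A\<^esub> x) = c \<odot>\<^bsub>B\<^esub> \<phi> x) \<and>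
      (\<forall>n. \<phi> ` alg_degree A n = alg_degree B n)}"

definition isomorphic_graded_algebras ::
    "('k, 'a) graded_algebra \<Rightarrow> ('k, 'b) graded_algebra \<Rightarrow> bool"
  where "isomorphic_graded_algebras A B \<longleftrightarrow> graded_algebra_iso A B \<noteq> {}"


section \<open>Quadratic algebras and quadratic coalgebras\<close>

text \<open>
  Throughout, \<open>V\<close> is the free vector space on the type \<^typ>\<open>'i\<close>, i.e. \<open>tensor_power 1\<close>, and \<open>R\<close> is a
  subspace of \<open>tensor_power 2\<close>.
\<close>

definition quadratic_algebra ::
    "('i, 'k::field) tensors set \<Rightarrow> ('k, ('i, 'k) tensors set) graded_algebra"
  where "quadratic_algebra R =
    quotient_algebra tensor_algebra (Idl\<^bsub>tensor_algebra :: ('k, ('i, 'k) tensors) graded_algebra\<^esub> R)"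

text \<open>
  A graded subcoalgebra of the tensor coalgebra is given by its homogeneous components; its
  comultiplication and counit are the restrictions of deconcatenation and of the projection to
  degree 0. The tensor square of the free space on words is the free space on pairs of words.
\<close>

record (overloaded) ('i, 'k) graded_coalgebra =
  coalg_degree :: "nat \<Rightarrow> ('i, 'k) tensors set"
  comult :: "('i, 'k) tensors \<Rightarrow> (('i list \<times> 'i list) \<Rightarrow>\<^sub>0 'k)"
  counit :: "('i, 'k) tensors \<Rightarrow> 'k"

definition deconcatenation :: "('i, 'k::field) tensors \<Rightarrow> (('i list \<times> 'i list) \<Rightarrow>\<^sub>0 'k)"
  where "deconcatenation x =
    (\<Sum>w \<in> Poly_Mapping.keys x. \<Sum>m \<le> length w.
      Poly_Mapping.single (take m w, drop m w) (Poly_Mapping.lookup x w))"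

definition sandwich ::
    "nat \<Rightarrow> ('i, 'k::field) tensors set \<Rightarrow> nat \<Rightarrow> ('i, 'k) tensors set"
    \<comment> \<open>the subspace \<open>V\<^sup>\<otimes>\<^sup>i \<otimes> R \<otimes> V\<^sup>\<otimes>\<^sup>j\<close>\<close>
  where "sandwich i R j =
    tensors.span {x * r * y | x r y. x \<in> tensor_power i \<and> r \<in> R \<and> y \<in> tensor_power j}"

definition quadratic_coalgebra :: "('i, 'k::field) tensors set \<Rightarrow> ('i, 'k) graded_coalgebra"
  where "quadratic_coalgebra R =
    \<lparr>coalg_degree = (\<lambda>n. if n < 2 then tensor_power n
                         else \<Inter> {sandwich i R j | i j. i + j + 2 = n}),
     comult = deconcatenation,
     counit = (\<lambda>x. Poly_Mapping.lookup x [])\<rparr>"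

text \<open>
  The coalgebra \<open>\<langle>V;R\<rangle>\<close> has \<open>R\<close> as its component of degree 2, so \<open>R\<close> can be read off from it.
\<close>

definition associated_algebra ::
    "('i, 'k::field) graded_coalgebra \<Rightarrow> ('k, ('i, 'k) tensors set) graded_algebra"
  where "associated_algebra C = quadratic_algebra (coalg_degree C 2)"


section \<open>Admissible quadratic coalgebras and algebras\<close>

text \<open>
  A function \<open>g : T \<times> T' \<rightarrow> K\<close>, with \<open>T'\<close> the complement of \<open>T\<close>, is a total function of which only
  the values on \<open>T \<times> -T\<close> are ever used.
\<close>

definition admissible_coeffs :: "('i \<times> 'i) set \<Rightarrow> ('i \<times> 'i \<Rightarrow> 'i \<times> 'i \<Rightarrow> 'k::field) \<Rightarrow> bool"
  where "admissible_coeffs T g \<longleftrightarrow> (\<forall>t \<in> T. finite {t' \<in> - T. g t t' \<noteq> 0})"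

definition admissible_relations ::
    "('i \<times> 'i) set \<Rightarrow> ('i \<times> 'i \<Rightarrow> 'i \<times> 'i \<Rightarrow> 'k::field) \<Rightarrow> ('i, 'k) tensors set"
  where "admissible_relations T g =
    tensors.span ((\<lambda>t. basis_pair t -
      (\<Sum>t' \<in> {t' \<in> - T. g t t' \<noteq> 0}. scale (g t t') (basis_pair t'))) ` T)"

definition admissible_coalgebra ::
    "('i \<times> 'i) set \<Rightarrow> ('i \<times> 'i \<Rightarrow> 'i \<times> 'i \<Rightarrow> 'k::field) \<Rightarrow> ('i, 'k) graded_coalgebra"
  where "admissible_coalgebra T g = quadratic_coalgebra (admissible_relations T g)"

definition dual_coeffs :: "('s \<Rightarrow> 't \<Rightarrow> 'k) \<Rightarrow> 't \<Rightarrow> 's \<Rightarrow> 'k"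
  where "dual_coeffs g = (\<lambda>t' t. g t t')"

definition dualizable_coeffs :: "('i \<times> 'i) set \<Rightarrow> ('i \<times> 'i \<Rightarrow> 'i \<times> 'i \<Rightarrow> 'k::field) \<Rightarrow> bool"
  where "dualizable_coeffs T g \<longleftrightarrow>
    admissible_coeffs T g \<and> (\<forall>t' \<in> - T. finite {t \<in> T. g t t' \<noteq> 0})"

definition strictly_self_dual_coeffs ::
    "('i \<times> 'i) set \<Rightarrow> ('i \<times> 'i \<Rightarrow> 'i \<times> 'i \<Rightarrow> 'k::field) \<Rightarrow> bool"
  where "strictly_self_dual_coeffs T g \<longleftrightarrow>
    dualizable_coeffs T g \<and>
    (\<exists>\<sigma>. bij \<sigma> \<and> bij_betw (map_prod \<sigma> \<sigma>) T (- T) \<and>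
      (\<forall>t \<in> T. \<forall>t' \<in> - T. g t t' = dual_coeffs g (map_prod \<sigma> \<sigma> t) (map_prod \<sigma> \<sigma> t')))"

text \<open>
  For a given \<open>T\<close>, the space of relations determines \<open>g\<close> on \<open>T \<times> -T\<close>, so that the existential
  quantifiers below involve no choice.
\<close>

definition dualizable_coalgebra ::
    "('i \<times> 'i) set \<Rightarrow> ('i, 'k::field) graded_coalgebra \<Rightarrow> bool"
  where "dualizable_coalgebra T C \<longleftrightarrow>
    (\<exists>g. C = admissible_coalgebra T g \<and> dualizable_coeffs T g)"

definition strictly_self_dual_coalgebra ::
    "('i \<times> 'i) set \<Rightarrow> ('i, 'k::field) graded_coalgebra \<Rightarrow> bool"
  where "strictly_self_dual_coalgebra T C \<longleftrightarrow>
    (\<exists>g. C = admissible_coalgebra T g \<and> strictly_self_dual_coeffs T g)"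

definition dualizable_algebra ::
    "('i \<times> 'i) set \<Rightarrow> ('k::field, ('i, 'k) tensors set) graded_algebra \<Rightarrow> bool"
  where "dualizable_algebra T A \<longleftrightarrow>
    (\<exists>R. tensors.subspace R \<and> R \<subseteq> tensor_power 2 \<and> A = quadratic_algebra R \<and>
      dualizable_coalgebra T (quadratic_coalgebra R))"

definition strictly_self_dual_algebra ::
    "('i \<times> 'i) set \<Rightarrow> ('k::field, ('i, 'k) tensors set) graded_algebra \<Rightarrow> bool"
  where "strictly_self_dual_algebra T A \<longleftrightarrow>
    (\<exists>R. tensors.subspace R \<and> R \<subseteq> tensor_power 2 \<and> A = quadratic_algebra R \<and>
      strictly_self_dual_coalgebra T (quadratic_coalgebra R))"


section \<open>The universal Steenrod algebra\<close>

definition int_binomial :: "int \<Rightarrow> int \<Rightarrow> nat"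
  where "int_binomial a b = (if a < 0 \<or> b < 0 then 0 else nat a choose nat b)"

text \<open>
  The sum over all integers \<open>j\<close> is restricted to the indices with nonzero binomial coefficient; they
  satisfy \<open>0 \<le> j < n\<close>. The case \<open>n = 0\<close> is included and gives the relation \<open>y\<^bsub>2k-1\<^esub> y\<^sub>k = 0\<close>.
\<close>

definition adem_relator :: "int \<Rightarrow> nat \<Rightarrow> (int, bit) tensors"
  where "adem_relator k n =
    basis_word [2 * k - 1 - int n, k] -
    (\<Sum>j | int_binomial (int n - 1 - j) j \<noteq> 0.
      scale (of_nat (int_binomial (int n - 1 - j) j))
        (basis_word [2 * k - 1 - j, k + j - int n]))"

definition universal_steenrod :: "(bit, (int, bit) tensors set) graded_algebra"
  where "universal_steenrod =
    quadratic_algebra (tensors.span (range (\<lambda>(k, n). adem_relator k n)))"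

definition steenrod_S :: "(int \<times> int) set"
  where "steenrod_S = {(i, j). i \<ge> 2 * j}"

definition steenrod_S' :: "(int \<times> int) set"
  where "steenrod_S' = {(i, j). i < 2 * j}"

lemma compl_steenrod_S': "- steenrod_S' = steenrod_S"
  by (auto simp: steenrod_S_def steenrod_S'_def)

definition steenrod_f :: "int \<times> int \<Rightarrow> int \<times> int \<Rightarrow> bit"
  where "steenrod_f = (\<lambda>(i, j) (l, m).
    if i + j = l + m then of_nat (int_binomial (m - j - 1) (m + j - l - 1)) else 0)"

end

theory Submission
  imports Defs
begin

text \<open>
  The pairs \<open>(2k-1-n, k)\<close> with \<open>n \<in> \<nat>\<close> enumerate \<open>\<S>'\<close>, and \<open>f\<close> is the coefficient function of the
  Adem relations in this enumeration; hence the relations of \<open>\<Q>\<close> are those of \<open>\<langle>\<int>; \<S>', f\<^sup>!\<rangle>\<close>. The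
  self-duality is \<open>\<sigma> i = 1 - i\<close>: on pairs of equal total degree it exchanges the binomial
  coefficients \<open>a choose b\<close> and \<open>a choose (a - b)\<close>.
\<close>

text \<open>The empty word is the unit of the monoid of words, so its multiples are central. The
  induction adds one monomial at a time, at a word not yet in the support, which makes the update a
  sum.\<close>

lemma single_Nil_commute:
  fixes x :: "('i, 'k::field) tensors"
  shows "x * Poly_Mapping.single [] c = Poly_Mapping.single [] c * x"
proof (induction x rule: update_induct)
  case (update x w a)
  have "Poly_Mapping.update w a x = x + Poly_Mapping.single w a"
    using update.hyps
    by (intro poly_mapping_eqI)
      (auto simp: lookup_update lookup_add lookup_single in_keys_iff)
  then show ?case
    using update.IH
    by (simp add: distrib_left distrib_right mult_single plus_list_def mult.commute)
qed simp

lemma tensor_power_0D: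
  assumes "x \<in> tensor_power 0"
  shows "x = Poly_Mapping.single [] (Poly_Mapping.lookup x [])"
proof (rule poly_mapping_eqI)
  fix w
  have "w \<notin> Poly_Mapping.keys x" if "w \<noteq> []"
    using assms that by (auto simp: tensor_power_def)
  then show "Poly_Mapping.lookup x w =
      Poly_Mapping.lookup (Poly_Mapping.single [] (Poly_Mapping.lookup x [])) w"
    by (cases "w = []") (simp_all add: lookup_single in_keys_iff)
qed

lemma one_in_tensor_power_0: "1 \<in> tensor_power 0"
  by (simp add: tensor_power_def zero_list_def)

lemma subspace_tensor_power: "tensors.subspace (tensor_power n :: ('i, 'k::field) tensors set)"
proof (rule tensors.subspaceI)
  show "0 \<in> tensor_power n"
    by (simp add: tensor_power_def)
next
  fix x y :: "('i, 'k) tensors"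
  assume "x \<in> tensor_power n" "y \<in> tensor_power n"
  then show "x + y \<in> tensor_power n"
    using Poly_Mapping.keys_add[of x y] by (auto simp: tensor_power_def)
next
  fix c and x :: "('i, 'k) tensors"
  assume "x \<in> tensor_power n"
  then show "scale c x \<in> tensor_power n"
    using keys_mult[of "Poly_Mapping.single [] c" x]
    by (fastforce simp: tensor_power_def scale_def plus_list_def split: if_splits)
qed

lemma basis_word_in_tensor_power: "length w = n \<Longrightarrow> basis_word w \<in> tensor_power n"
  by (simp add: tensor_power_def basis_word_def)

text \<open>Degree 0 contains only scalars, so each product \<open>x * r * y\<close> is a scalar
  multiple of \<open>r\<close>.\<close>

lemma sandwich_0_0:
  fixes R :: "('i, 'k::field) tensors set"
  assumes "tensors.subspace R"
  shows "sandwich 0 R 0 = R"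
proof -
  have "{x * r * y | x r y. x \<in> tensor_power 0 \<and> r \<in> R \<and> y \<in> tensor_power 0} = R" (is "?A = R")
  proof
    show "?A \<subseteq> R"
    proof safe
      fix x r y :: "('i, 'k) tensors"
      assume "x \<in> tensor_power 0" "r \<in> R" "y \<in> tensor_power 0"
      then obtain c d where "x = Poly_Mapping.single [] c" "y = Poly_Mapping.single [] d"
        by (metis tensor_power_0D)
      then have "x * r * y = scale d (scale c r)"
        by (simp add: scale_def single_Nil_commute)
      then show "x * r * y \<in> R"
        using assms \<open>r \<in> R\<close> by (simp add: tensors.subspace_scale)
    qed
    show "R \<subseteq> ?A"
    proof
      fix r assume "r \<in> R"
      then have "r = 1 * r * 1 \<and> 1 \<in> tensor_power 0 \<and> r \<in> R"
        by (simp add: one_in_tensor_power_0)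
      then show "r \<in> ?A"
        using one_in_tensor_power_0 by blast
    qed
  qed
  then show ?thesis
    using assms by (simp add: sandwich_def tensors.span_eq_iff)
qed

text \<open>In degree 2 the intersection has the single term \<open>i = j = 0\<close>, so
  \<open>R\<close> is recovered from the coalgebra.\<close>

lemma associated_algebra_quadratic_coalgebra:
  assumes "tensors.subspace R"
  shows "associated_algebra (quadratic_coalgebra R) = quadratic_algebra R"
proof -
  have "{sandwich i R j | i j. i + j + 2 = (2::nat)} = {sandwich 0 R 0}"
    by auto
  then show ?thesis
    using assms by (simp add: associated_algebra_def quadratic_coalgebra_def sandwich_0_0)
qed

lemma isomorphic_graded_algebras_refl: "isomorphic_graded_algebras A A"
proof -
  have "id \<in> graded_algebra_iso A A"
    by (auto simp: graded_algebra_iso_def ring_iso_def ring_hom_def)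
  then show ?thesis
    by (auto simp: isomorphic_graded_algebras_def)
qed

lemma int_binomial_pos_iff: "int_binomial a b > 0 \<longleftrightarrow> 0 \<le> b \<and> b \<le> a"
  by (auto simp: int_binomial_def)

text \<open>No bounds on \<open>b\<close> are required: \<open>b\<close> and \<open>a - b\<close>
  lie in the range from 0 to \<open>a\<close> together, and outside it both sides vanish.\<close>

lemma int_binomial_symmetric: "int_binomial a (a - b) = int_binomial a b"
proof (cases "0 \<le> b \<and> b \<le> a")
  case True
  then show ?thesis
    by (simp add: int_binomial_def nat_diff_distrib nat_mono binomial_symmetric[symmetric])
next
  case False
  then show ?thesis
    using int_binomial_pos_iff[of a b] int_binomial_pos_iff[of a "a - b"] by auto
qed

text \<open>An odd binomial coefficient is positive, which bounds its lower entry. Once one of the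
  two pairs is fixed, only finitely many choices remain for the other.\<close>

lemma steenrod_f_eq_1D:
  assumes "steenrod_f (i, j) (l, m) = 1"
  shows "i + j = l + m \<and> 0 \<le> m + j - l - 1 \<and> m + j - l - 1 \<le> m - j - 1"
proof -
  have "int_binomial (m - j - 1) (m + j - l - 1) > 0"
    using assms by (intro Nat.gr0I) (simp add: steenrod_f_def split: if_splits)
  then show ?thesis
    using assms by (simp add: int_binomial_pos_iff steenrod_f_def split: if_splits)
qed

lemma steenrod_f_adem:
  "steenrod_f (2 * k - 1 - j, k + j - n) (2 * k - 1 - n, k) = of_nat (int_binomial (n - 1 - j) j)"
  by (simp add: steenrod_f_def algebra_simps)

lemma adem_relator_eq:
  fixes k :: int and n :: nat
  defines "t \<equiv> (2 * k - 1 - int n, k)"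
  shows "adem_relator k n = basis_pair t -
    (\<Sum>t' \<in> {t' \<in> - steenrod_S'. dual_coeffs steenrod_f t t' \<noteq> 0}.
      scale (dual_coeffs steenrod_f t t') (basis_pair t'))"
proof -
  define b where "b j = int_binomial (int n - 1 - j) j" for j
  define p where "p j = (2 * k - 1 - j, k + j - int n)" for j
  have f_p: "dual_coeffs steenrod_f t (p j) = of_nat (b j)" for j
    by (simp add: dual_coeffs_def t_def p_def b_def steenrod_f_adem)
  have fin: "finite {j. b j \<noteq> 0}"
    by (rule finite_subset[of _ "{0..int n}"]) (auto simp: b_def int_binomial_pos_iff)
  \<comment> \<open>\<open>p\<close> runs through all pairs with the total degree of
    \<open>t\<close>. Conversely, a nonzero \<open>b j\<close> gives
    \<open>0 <= j <= n - 1 - j\<close>, hence \<open>3 * j <= 2 * n - 2\<close>, which puts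
    \<open>p j\<close> outside \<open>steenrod_S'\<close>.\<close>
  have image: "{t' \<in> - steenrod_S'. dual_coeffs steenrod_f t t' \<noteq> 0} = p ` {j. (of_nat (b j) :: bit) \<noteq> 0}"
  proof (intro equalityI subsetI)
    fix t' assume t': "t' \<in> {t' \<in> - steenrod_S'. dual_coeffs steenrod_f t t' \<noteq> 0}"
    obtain i j where ij: "t' = (i, j)"
      by fastforce
    have "i + j = 2 * k - 1 - int n + k"
      using t' by (auto simp: ij dual_coeffs_def t_def dest: steenrod_f_eq_1D)
    then have "t' = p (2 * k - 1 - i)"
      by (simp add: ij p_def)
    then show "t' \<in> p ` {j. (of_nat (b j) :: bit) \<noteq> 0}"
      using t' f_p by auto
  next
    fix t' assume "t' \<in> p ` {j. (of_nat (b j) :: bit) \<noteq> 0}"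
    then obtain j where j: "t' = p j" "(of_nat (b j) :: bit) \<noteq> 0"
      by auto
    then have "b j \<noteq> 0"
      by (intro notI) simp
    then show "t' \<in> {t' \<in> - steenrod_S'. dual_coeffs steenrod_f t t' \<noteq> 0}"
      using j f_p[of j] by (auto simp: b_def int_binomial_pos_iff p_def steenrod_S'_def)
  qed
  have "adem_relator k n = basis_pair t - (\<Sum>j | b j \<noteq> 0. scale (of_nat (b j)) (basis_pair (p j)))"
    by (simp add: adem_relator_def basis_pair_def t_def b_def p_def)
  \<comment> \<open>The indices lost here have a nonzero but even \<open>b j\<close>, so their terms
    are zero over \<open>bit\<close>.\<close>
  also have "(\<Sum>j | b j \<noteq> 0. scale (of_nat (b j) :: bit) (basis_pair (p j))) =
      (\<Sum>j | (of_nat (b j) :: bit) \<noteq> 0. scale (of_nat (b j)) (basis_pair (p j)))"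
    by (rule sum.mono_neutral_right[OF fin]) (auto intro!: Nat.gr0I)
  also have "\<dots> = (\<Sum>t' \<in> p ` {j. (of_nat (b j) :: bit) \<noteq> 0}.
      scale (dual_coeffs steenrod_f t t') (basis_pair t'))"
    by (subst sum.reindex) (auto simp: inj_on_def p_def f_p[unfolded p_def])
  finally show ?thesis
    by (simp only: image)
qed

lemma steenrod_S'_eq_range: "steenrod_S' = range (\<lambda>(k, n). (2 * k - 1 - int n, k))"
proof (intro equalityI subsetI)
  fix t assume "t \<in> steenrod_S'"
  then obtain l m where "t = (l, m)" "l < 2 * m"
    by (auto simp: steenrod_S'_def)
  \<comment> \<open>The second entry is solved from \<open>l = 2 * m - 1 - n\<close>; it is
    nonnegative exactly because \<open>l < 2 * m\<close>.\<close>
  then have "t = (\<lambda>(k, n). (2 * k - 1 - int n, k)) (m, nat (2 * m - 1 - l))"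
    by simp
  then show "t \<in> range (\<lambda>(k, n). (2 * k - 1 - int n, k))"
    by blast
qed (auto simp: steenrod_S'_def)

lemma span_adem_relators:
  "tensors.span (range (\<lambda>(k, n). adem_relator k n)) =
    admissible_relations steenrod_S' (dual_coeffs steenrod_f)"
proof -
  define r where "r t = (basis_pair t :: (int, bit) tensors) -
    (\<Sum>t' \<in> {t' \<in> - steenrod_S'. dual_coeffs steenrod_f t t' \<noteq> 0}.
      scale (dual_coeffs steenrod_f t t') (basis_pair t'))" for t
  have "(\<lambda>(k, n). adem_relator k n) = r \<circ> (\<lambda>(k, n). (2 * k - 1 - int n, k))"
    unfolding fun_eq_iff r_def by (auto simp only: adem_relator_eq comp_def prod.case split_paired_All)
  then have "range (\<lambda>(k, n). adem_relator k n) = r ` steenrod_S'"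
    by (simp only: steenrod_S'_eq_range image_comp)
  then show ?thesis
    by (simp only: admissible_relations_def r_def[abs_def])
qed

lemma adem_relator_in_tensor_power: "adem_relator k n \<in> tensor_power 2"
  unfolding adem_relator_def
  by (intro tensors.subspace_diff tensors.subspace_sum tensors.subspace_scale
      subspace_tensor_power basis_word_in_tensor_power) simp_all

lemma dualizable_coeffs_steenrod: "dualizable_coeffs steenrod_S' (dual_coeffs steenrod_f)"
  unfolding dualizable_coeffs_def admissible_coeffs_def
proof safe
  fix l m
  \<comment> \<open>The total degree is fixed, so \<open>j\<close> determines the pair. The lower
    end comes from \<open>0 <= m + j - l - 1\<close>, the upper end from
    \<open>0 <= m - j - 1\<close>.\<close>
  have "{t' \<in> - steenrod_S'. dual_coeffs steenrod_f (l, m) t' \<noteq> 0}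
      \<subseteq> (\<lambda>j. (l + m - j, j)) ` {l + 1 - m..m - 1}"
    by (auto simp: dual_coeffs_def image_iff dest: steenrod_f_eq_1D)
  then show "finite {t' \<in> - steenrod_S'. dual_coeffs steenrod_f (l, m) t' \<noteq> 0}"
    by (rule finite_subset) simp
next
  fix i j
  \<comment> \<open>Now \<open>m\<close> determines the pair. The upper end is
    \<open>2 * j <= l\<close> with \<open>l = i + j - m\<close> substituted.\<close>
  have "{t \<in> steenrod_S'. dual_coeffs steenrod_f t (i, j) \<noteq> 0}
      \<subseteq> (\<lambda>m. (i + j - m, m)) ` {j + 1..i - j}"
    by (auto simp: dual_coeffs_def image_iff dest: steenrod_f_eq_1D)
  then show "finite {t \<in> steenrod_S'. dual_coeffs steenrod_f t (i, j) \<noteq> 0}"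
    by (rule finite_subset) simp
qed

lemma steenrod_f_reflect:
  "steenrod_f (1 - l, 1 - m) (1 - i, 1 - j) = steenrod_f (i, j) (l, m)"
proof (cases "i + j = l + m")
  case True
  \<comment> \<open>The reflection keeps the upper entry of the binomial and complements the lower
    one; the latter uses the equality of total degrees.\<close>
  then have "1 - j + (1 - m) - (1 - i) - 1 = (m - j - 1) - (m + j - l - 1)"
    and "1 - j - (1 - m) - 1 = m - j - 1"
    and "1 - l + (1 - m) = 1 - i + (1 - j)"
    by simp_all
  then show ?thesis
    using True by (simp only: steenrod_f_def prod.case int_binomial_symmetric simp_thms if_True)
qed (auto simp: steenrod_f_def)

lemma strictly_self_dual_coeffs_steenrod:
  "strictly_self_dual_coeffs steenrod_S' (dual_coeffs steenrod_f)"
proof -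
  \<comment> \<open>The shift by 1 matches strict with weak inequality: over the integers,
    \<open>i < 2 * j\<close> is equivalent to \<open>1 - i >= 2 * (1 - j)\<close>.\<close>
  define \<sigma> :: "int \<Rightarrow> int" where "\<sigma> i = 1 - i" for i
  have "bij \<sigma>"
    by (rule o_bij[of \<sigma>]) (auto simp: \<sigma>_def)
  moreover have "bij_betw (map_prod \<sigma> \<sigma>) steenrod_S' (- steenrod_S')"
    by (rule bij_betwI[where g = "map_prod \<sigma> \<sigma>"]) (auto simp: \<sigma>_def steenrod_S'_def)
  \<comment> \<open>The double dual on the right is \<open>steenrod_f\<close> itself, so this is the
    reflection identity with \<open>t = (l, m)\<close> and \<open>t' = (i, j)\<close>.\<close>
  moreover have "dual_coeffs steenrod_f t t' =
      dual_coeffs (dual_coeffs steenrod_f) (map_prod \<sigma> \<sigma> t) (map_prod \<sigma> \<sigma> t')" for t t'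
    by (cases t; cases t') (simp add: dual_coeffs_def \<sigma>_def steenrod_f_reflect)
  ultimately show ?thesis
    using dualizable_coeffs_steenrod unfolding strictly_self_dual_coeffs_def by blast
qed

theorem theorem6p2p2:
  shows "(admissible_coeffs steenrod_S' (dual_coeffs steenrod_f) \<and>
      isomorphic_graded_algebras universal_steenrod
        (associated_algebra (admissible_coalgebra steenrod_S' (dual_coeffs steenrod_f)))) \<and>
    (dualizable_algebra steenrod_S' universal_steenrod \<and>
      strictly_self_dual_algebra steenrod_S' universal_steenrod)"
proof -
  define R where "R = admissible_relations steenrod_S' (dual_coeffs steenrod_f)"
  have Q: "universal_steenrod = quadratic_algebra R"
    by (simp add: universal_steenrod_def span_adem_relators R_def)
  have subspace: "tensors.subspace R"
    by (simp add: R_def admissible_relations_def tensors.subspace_span)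
  \<comment> \<open>Homogeneity is read off the Adem relators, which are combinations of words of
    length 2.\<close>
  have degree: "R \<subseteq> tensor_power 2"
    unfolding R_def span_adem_relators[symmetric]
    by (rule tensors.span_minimal) (auto simp: adem_relator_in_tensor_power subspace_tensor_power)
  have C: "quadratic_coalgebra R = admissible_coalgebra steenrod_S' (dual_coeffs steenrod_f)"
    by (simp add: admissible_coalgebra_def R_def)
  have "dualizable_coalgebra steenrod_S' (quadratic_coalgebra R)"
    using C dualizable_coeffs_steenrod unfolding dualizable_coalgebra_def by blast
  then have "dualizable_algebra steenrod_S' universal_steenrod"
    using subspace degree Q unfolding dualizable_algebra_def by blast
  moreover have "strictly_self_dual_coalgebra steenrod_S' (quadratic_coalgebra R)"
    using C strictly_self_dual_coeffs_steenrod unfolding strictly_self_dual_coalgebra_def by blast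
  then have "strictly_self_dual_algebra steenrod_S' universal_steenrod"
    using subspace degree Q unfolding strictly_self_dual_algebra_def by blast
  moreover have "admissible_coeffs steenrod_S' (dual_coeffs steenrod_f)"
    using dualizable_coeffs_steenrod by (simp add: dualizable_coeffs_def)
  \<comment> \<open>The two algebras are equal, so the identity serves as the isomorphism.\<close>
  moreover have "associated_algebra (admissible_coalgebra steenrod_S' (dual_coeffs steenrod_f)) =
      universal_steenrod"
    using subspace by (simp only: C[symmetric] associated_algebra_quadratic_coalgebra Q)
  ultimately show ?thesis
    by (simp only: isomorphic_graded_algebras_refl simp_thms)
qed

end
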